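(* For identical machines with cardinality-budget uncertainty and every real $\lambda>0$, there is a deterministic algorithm that, given the numbers of machines $m$ and jobs $n$, lower and upper job sizes $p^-,p^+\in\mathbb R_{\ge0}^n$ with $p^-\le p^+$, and a predicted size vector $\hat p$ with $p^-\le\hat p\le p^+$, computes a schedule $\mathcal S$, independently of the budget $\Gamma$, such that $$C_{\max}(\mathcal S,\hat p)\le\Big(1+\frac2\lambda\Big)\mathrm{OPT}(\hat p)$$ and, simultaneously for every $\Gamma\in\{1,\dots,n\}$, $$\max_{p\in\mathcal U_\Gamma}C_{\max}(\mathcal S,p)\le(10\lambda+20)\,\mathrm{OPT}^{\mathrm{rob}}(\mathcal U_\Gamma).$$
   Context: There are $m$ identical machines and $n$ jobs; a scenario is a vector $p\in\mathbb R_{\ge0}^n$ of job sizes. A schedule is a partition $\mathcal S=(S_1,\dots,S_m)$ of $[n]$ (parts may be empty), and $C_{\max}(\mathcal S,p)=\max_{i\in[m]}\sum_{j\in S_i}p_j$. $\mathrm{OPT}(p)=\min_{\mathcal S}C_{\max}(\mathcal S,p)$ and $\mathrm{OPT}^{\mathrm{rob}}(\mathcal U)=\min_{\mathcal S}\max_{p\in\mathcal U}C_{\max}(\mathcal S,p)$. For an integer $\Gamma\in\{1,\dots,n\}$, the cardinality-budget uncertainty set is $$\mathcal U_\Gamma=\{p:\exists\,T\subseteq[n],\ |T|\le\Gamma,\ p_j=p_j^-\text{ for }j\notin T,\ p_j\in[p_j^-,p_j^+]\text{ for }j\in T\}.$$ No computational restriction is imposed on the algorithm. *)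

theory Defs
  imports "HOL-Analysis.Analysis"
begin

text \<open>Vectors indexed by \<open>{1..n}\<close> are functions that are extensional on \<open>{1..n}\<close>, so that
  equal vectors are equal functions.\<close>

definition scenarios :: "nat \<Rightarrow> (nat \<Rightarrow> real) set" where
  "scenarios n = {1..n} \<rightarrow>\<^sub>E {0..}"

definition schedules :: "nat \<Rightarrow> nat \<Rightarrow> (nat \<Rightarrow> nat set) set" where
  "schedules m n = {S \<in> {1..m} \<rightarrow>\<^sub>E Pow {1..n}.
     disjoint_family_on S {1..m} \<and> (\<Union>i\<in>{1..m}. S i) = {1..n}}"

definition Cmax :: "nat \<Rightarrow> (nat \<Rightarrow> nat set) \<Rightarrow> (nat \<Rightarrow> real) \<Rightarrow> real" where
  "Cmax m S p = Max ((\<lambda>i. \<Sum>j\<in>S i. p j) ` {1..m})"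

definition OPT :: "nat \<Rightarrow> nat \<Rightarrow> (nat \<Rightarrow> real) \<Rightarrow> real" where
  "OPT m n p = Min ((\<lambda>S. Cmax m S p) ` schedules m n)"

text \<open>The maximum over an uncertainty set is written as a supremum, since such a set is in general
  infinite. For budgeted uncertainty it is attained, see \<open>Cmax_worst_attained\<close> below.\<close>

definition Cmax_worst :: "nat \<Rightarrow> (nat \<Rightarrow> nat set) \<Rightarrow> (nat \<Rightarrow> real) set \<Rightarrow> real" where
  "Cmax_worst m S U = (SUP p\<in>U. Cmax m S p)"

definition OPT_rob :: "nat \<Rightarrow> nat \<Rightarrow> (nat \<Rightarrow> real) set \<Rightarrow> real" where
  "OPT_rob m n U = Min ((\<lambda>S. Cmax_worst m S U) ` schedules m n)"

definition budget_set ::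
  "nat \<Rightarrow> (nat \<Rightarrow> real) \<Rightarrow> (nat \<Rightarrow> real) \<Rightarrow> nat \<Rightarrow> (nat \<Rightarrow> real) set" where
  "budget_set n pl pu \<Gamma> = {p \<in> scenarios n. \<exists>T\<subseteq>{1..n}. card T \<le> \<Gamma> \<and>
     (\<forall>j\<in>{1..n} - T. p j = pl j) \<and> (\<forall>j\<in>T. p j \<in> {pl j..pu j})}"

text \<open>An algorithm without computational restrictions is a function from \<open>m\<close>, \<open>n\<close>, the lower
  sizes, the upper sizes and the predicted sizes to a schedule. The budget is not an argument.\<close>

type_synonym sched_algorithm =
  "nat \<Rightarrow> nat \<Rightarrow> (nat \<Rightarrow> real) \<Rightarrow> (nat \<Rightarrow> real) \<Rightarrow> (nat \<Rightarrow> real) \<Rightarrow> (nat \<Rightarrow> nat set)"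

lemma finite_schedules: "finite (schedules m n)"
  by (rule finite_subset[of _ "{1..m} \<rightarrow>\<^sub>E Pow {1..n}"])
     (auto simp: schedules_def intro!: finite_PiE)

lemma schedules_nonempty:
  assumes "m \<ge> 1"
  shows "schedules m n \<noteq> {}"
proof -
  have "restrict (\<lambda>i. if i = 1 then {1..n} else {}) {1..m} \<in> schedules m n"
    using assms by (auto simp: schedules_def disjoint_family_on_def split: if_splits)
  then show ?thesis by blast
qed

lemma Cmax_mono:
  assumes "m \<ge> 1" "S \<in> schedules m n" "\<And>j. j \<in> {1..n} \<Longrightarrow> p j \<le> q j"
  shows "Cmax m S p \<le> Cmax m S q"
proof -
  have "(\<Sum>j\<in>S i. p j) \<le> Cmax m S q" if i: "i \<in> {1..m}" for i
  proof -
    have "S i \<subseteq> {1..n}"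
      using assms(2) i by (auto simp: schedules_def)
    then have "(\<Sum>j\<in>S i. p j) \<le> (\<Sum>j\<in>S i. q j)"
      using assms(3) by (intro sum_mono) blast
    also have "\<dots> \<le> Cmax m S q"
      unfolding Cmax_def using i by (intro Max_ge) auto
    finally show ?thesis .
  qed
  then show ?thesis
    unfolding Cmax_def[of m S p] using assms(1) by (subst Max_le_iff) auto
qed

lemma Cmax_worst_attained:
  assumes "m \<ge> 1" "S \<in> schedules m n" "pl \<in> scenarios n" "pu \<in> scenarios n"
    and le: "\<forall>j\<in>{1..n}. pl j \<le> pu j"
  obtains p where "p \<in> budget_set n pl pu \<Gamma>"
    and "Cmax_worst m S (budget_set n pl pu \<Gamma>) = Cmax m S p"
    and "\<And>q. q \<in> budget_set n pl pu \<Gamma> \<Longrightarrow> Cmax m S q \<le> Cmax m S p"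
proof -
  define V where "V = (\<lambda>T j. if j \<in> T then pu j else pl j)"
  define TT where "TT = {T. T \<subseteq> {1..n} \<and> card T \<le> \<Gamma>}"
  have fin: "finite TT" and ne: "TT \<noteq> {}"
    by (simp_all add: TT_def) (metis card.empty empty_subsetI zero_le)
  have VU: "V T \<in> budget_set n pl pu \<Gamma>" if "T \<in> TT" for T
  proof -
    have T: "T \<subseteq> {1..n}" "card T \<le> \<Gamma>"
      using that by (auto simp: TT_def)
    have "V T j \<in> {0..}" if "j \<in> {1..n}" for j
      using PiE_mem[OF assms(3)[unfolded scenarios_def] that]
        PiE_mem[OF assms(4)[unfolded scenarios_def] that] by (simp add: V_def)
    moreover have "V T j = undefined" if "j \<notin> {1..n}" for j
      using PiE_arb[OF assms(3)[unfolded scenarios_def] that] T(1) that by (auto simp: V_def)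
    ultimately have "V T \<in> scenarios n"
      unfolding scenarios_def by (rule PiE_I)
    moreover have "\<forall>j\<in>{1..n} - T. V T j = pl j"
      by (simp add: V_def)
    moreover have "\<forall>j\<in>T. V T j \<in> {pl j..pu j}"
      using le T(1) by (simp add: V_def subset_iff)
    ultimately show ?thesis
      using T unfolding budget_set_def by blast
  qed
  have "Max ((\<lambda>T. Cmax m S (V T)) ` TT) \<in> (\<lambda>T. Cmax m S (V T)) ` TT"
    using fin ne by (intro Max_in) auto
  then obtain T where T: "T \<in> TT" and Tmax: "Max ((\<lambda>T. Cmax m S (V T)) ` TT) = Cmax m S (V T)"
    by auto
  have ub: "Cmax m S q \<le> Cmax m S (V T)" if "q \<in> budget_set n pl pu \<Gamma>" for q
  proof -
    from that obtain R where R: "R \<subseteq> {1..n}" "card R \<le> \<Gamma>"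
      "\<forall>j\<in>{1..n} - R. q j = pl j" "\<forall>j\<in>R. q j \<in> {pl j..pu j}"
      unfolding budget_set_def by blast
    have "Cmax m S q \<le> Cmax m S (V R)"
      using R by (intro Cmax_mono[OF assms(1,2)]) (auto simp: V_def)
    also have "\<dots> \<le> Cmax m S (V T)"
      unfolding Tmax[symmetric] using fin R by (intro Max_ge) (auto simp: TT_def)
    finally show ?thesis .
  qed
  have "Cmax_worst m S (budget_set n pl pu \<Gamma>) = Cmax m S (V T)"
    unfolding Cmax_worst_def using VU[OF T] ub by (intro cSup_eq_maximum) auto
  with that VU[OF T] ub show ?thesis by blast
qed

end

theory Submission
  imports Defs
begin

text \<open>Let \<open>D\<close> be the optimum for the prediction. Jobs of predicted size above \<open>D / (6 \<lambda>)\<close> stay on their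
  machines in an optimal schedule for the prediction: there are at most \<open>6 \<lambda>\<close> of them per
  machine, and each has upper size at most the robust optimum \<open>R\<close>. The remaining, small jobs are
  split fractionally, each giving the same share \<open>w\<^sub>i\<close> to machine \<open>i\<close>; the shares are uniform when
  the small jobs have total predicted size at most \<open>m D / \<lambda>\<close>, and otherwise proportional to the
  small load in the optimal schedule, so that in both cases \<open>w\<^sub>i m \<le> 1 + \<lambda>\<close>.

  The fractional assignment is rounded in the manner of Beck and Fiala, almost preserving on each
  machine the load under the prediction, the load under the lower sizes, and the number of jobs
  from each block of \<open>m\<close> jobs that are consecutive when sorted by deviation. The last property
  controls, for all \<open>\<Gamma>\<close> at once, the total deviation of the jobs with deviation above
  \<open>R / \<Gamma>\<close>, while at most \<open>\<Gamma>\<close> attacked jobs below this threshold add at most \<open>R\<close>.\<close>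

section \<open>Linear algebra and iterated rounding\<close>

text \<open>Gaussian elimination, one equation at a time: an equation with a nonzero coefficient at
  \<open>u\<close> is solved for \<open>u\<close>. Substituting into the others removes one equation
  and one variable, so the surplus of variables persists.\<close>

lemma homogeneous_system_nontrivial_solution:
  fixes a :: "'c \<Rightarrow> 'v \<Rightarrow> real"
  assumes "finite C" "finite V" "card C < card V"
  shows "\<exists>z. (\<exists>v\<in>V. z v \<noteq> 0) \<and> (\<forall>c\<in>C. (\<Sum>v\<in>V. a c v * z v) = 0)"
  using assms
proof (induction C arbitrary: a V rule: finite_induct)
  case empty
  then obtain v where "v \<in> V" by fastforce
  then show ?case by (intro exI[of _ "\<lambda>_. 1"]) auto
next
  case (insert c C)
  show ?case
  proof (cases "\<forall>v\<in>V. a c v = 0")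
    case True
    then show ?thesis using insert.IH[of V a] insert.prems insert.hyps by simp
  next
    case False
    then obtain u where u: "u \<in> V" "a c u \<noteq> 0" by blast
    define a' where "a' = (\<lambda>d v. a d v - a d u / a c u * a c v)"
    have "card C < card (V - {u})"
      using insert.prems insert.hyps u by simp
    then obtain z where z: "\<exists>v\<in>V - {u}. z v \<noteq> 0"
      "\<forall>d\<in>C. (\<Sum>v\<in>V - {u}. a' d v * z v) = 0"
      using insert.IH[of "V - {u}" a'] insert.prems by auto
    define s where "s = (\<Sum>v\<in>V - {u}. a c v * z v)"
    \<comment> \<open>The value at \<open>u\<close> solves equation \<open>c\<close>; the correction
      built into \<open>a'\<close> then makes the other original equations hold as well.\<close>
    define z' where "z' = z(u := - s / a c u)"
    have split: "(\<Sum>v\<in>V. a d v * z' v) = (\<Sum>v\<in>V - {u}. a d v * z v) - a d u * s / a c u" for d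
    proof -
      have "(\<Sum>v\<in>V. a d v * z' v) = a d u * z' u + (\<Sum>v\<in>V - {u}. a d v * z' v)"
        using insert.prems u by (intro sum.remove) auto
      also have "(\<Sum>v\<in>V - {u}. a d v * z' v) = (\<Sum>v\<in>V - {u}. a d v * z v)"
        by (intro sum.cong) (auto simp: z'_def)
      finally show ?thesis by (simp add: z'_def)
    qed
    have "(\<Sum>v\<in>V. a d v * z' v) = 0" if "d \<in> insert c C" for d
    proof (cases "d = c")
      case True
      then show ?thesis using split[of c] u by (simp add: s_def)
    next
      case False
      then have "(\<Sum>v\<in>V - {u}. a' d v * z v) = 0" using that z by auto
      moreover have "(\<Sum>v\<in>V - {u}. a' d v * z v) = (\<Sum>v\<in>V - {u}. a d v * z v) - a d u / a c u * s"
        by (simp add: a'_def s_def left_diff_distrib sum_subtractf sum_distrib_left mult.assoc)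
      ultimately show ?thesis using split[of d] by simp
    qed
    moreover have "\<exists>v\<in>V. z' v \<noteq> 0" using z(1) by (auto simp: z'_def)
    ultimately show ?thesis by blast
  qed
qed

text \<open>The point starts in the interior of the unit cube and moves along \<open>z\<close> until
  it first meets the boundary.\<close>

lemma move_until_integral:
  fixes x z :: "'v \<Rightarrow> real"
  assumes "finite F" and x: "\<And>v. v \<in> F \<Longrightarrow> 0 < x v \<and> x v < 1" and nz: "\<exists>v\<in>F. z v \<noteq> 0"
  shows "\<exists>s. (\<forall>v\<in>F. 0 \<le> x v + s * z v \<and> x v + s * z v \<le> 1) \<and> (\<exists>v\<in>F. x v + s * z v \<in> {0, 1})"
proof -
  define Z where "Z = {v \<in> F. z v \<noteq> 0}"
  \<comment> \<open>\<open>q v\<close> is the time at which a coordinate moving up reaches 1, or one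
    moving down reaches 0; the least such time keeps all coordinates between 0 and 1. Resting
    coordinates must be left out, since division by zero would give them time 0.\<close>
  define q where "q = (\<lambda>v. if z v > 0 then (1 - x v) / z v else x v / (- z v))"
  define s where "s = Min (q ` Z)"
  have Z: "finite (q ` Z)" "q ` Z \<noteq> {}" using assms by (auto simp: Z_def)
  obtain u where u: "u \<in> Z" "s = q u" using Min_in[OF Z] by (auto simp: s_def)
  have pos: "s > 0" using u x[of u] by (auto simp: q_def Z_def divide_pos_neg)
  have le: "s \<le> q v" if "v \<in> Z" for v
    using Z that by (auto simp: s_def)
  have "0 \<le> x v + s * z v \<and> x v + s * z v \<le> 1" if v: "v \<in> F" for v
  proof -
    consider "z v = 0" | "z v > 0" | "z v < 0" by linarith
    then show ?thesis
    proof cases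
      case 2
      then have "s \<le> (1 - x v) / z v" using le[of v] v by (auto simp: Z_def q_def)
      then have "s * z v \<le> 1 - x v" using 2 by (simp add: pos_le_divide_eq)
      moreover have "0 \<le> s * z v" using pos 2 by simp
      ultimately show ?thesis using x[OF v] by linarith
    next
      case 3
      then have "s \<le> x v / (- z v)" using le[of v] v by (auto simp: Z_def q_def)
      then have "s * (- z v) \<le> x v" using 3 by (subst (asm) pos_le_divide_eq) auto
      moreover have "0 \<le> s * (- z v)" using pos 3 by (intro mult_nonneg_nonneg) auto
      ultimately show ?thesis using x[OF v] by simp
    qed (use x[OF v] in simp)
  qed
  moreover have "x u + s * z u \<in> {0, 1}"
    using u by (auto simp: q_def Z_def)
  moreover have "u \<in> F" using u by (simp add: Z_def)
  ultimately show ?thesis by blast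
qed

text \<open>Fibres are disjoint. With \<open>K\<close> as threshold, this limits how many
  constraints of one family are enforced at the same time.\<close>

lemma card_heavy_fibres:
  assumes "finite F"
  shows "K * card {b \<in> g ` F. K \<le> card {v \<in> F. g v = b}} \<le> card F"
proof -
  let ?H = "{b \<in> g ` F. K \<le> card {v \<in> F. g v = b}}"
  have "K * card ?H = (\<Sum>b\<in>?H. K)" by simp
  also have "\<dots> \<le> (\<Sum>b\<in>?H. card {v \<in> F. g v = b})" by (intro sum_mono) auto
  also have "\<dots> \<le> (\<Sum>b\<in>g ` F. card {v \<in> F. g v = b})"
    using assms by (intro sum_mono2) auto
  also have "\<dots> = card F"
    using assms sum.image_gen[OF assms, of "\<lambda>_. 1::nat" g] by simp
  finally show ?thesis .
qed

text \<open>A constraint \<open>(k, b)\<close> is enforced as long as its group contains at least \<open>L k\<close> fractional variables.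
  Fewer constraints than fractional variables are then enforced, so one can move along a kernel
  direction until a further variable becomes integral. The witness \<open>x'\<close> is the state in which the
  constraint is dropped.\<close>

lemma iterated_rounding:
  fixes x :: "'v \<Rightarrow> real" and s :: "'k \<Rightarrow> 'v \<Rightarrow> real" and g :: "'k \<Rightarrow> 'v \<Rightarrow> 'b" and L :: "'k \<Rightarrow> nat"
  assumes "finite V" "finite K" and Lpos: "\<And>k. k \<in> K \<Longrightarrow> 0 < L k"
    and Lsum: "(\<Sum>k\<in>K. 1 / real (L k)) < 1"
    and "\<And>v. v \<in> V \<Longrightarrow> 0 \<le> x v \<and> x v \<le> 1"
  shows "\<exists>y. (\<forall>v\<in>V. y v \<in> {0, 1} \<and> (x v \<in> {0, 1} \<longrightarrow> y v = x v)) \<and>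
    (\<forall>k\<in>K. \<forall>b. \<exists>x'. (\<forall>v\<in>V. 0 \<le> x' v \<and> x' v \<le> 1 \<and> (x' v \<in> {0, 1} \<longrightarrow> y v = x' v)) \<and>
      (\<Sum>v | v \<in> V \<and> g k v = b. s k v * x' v) = (\<Sum>v | v \<in> V \<and> g k v = b. s k v * x v) \<and>
      card {v \<in> V. g k v = b \<and> x' v \<notin> {0, 1}} < L k)"
  using assms(5)
proof (induction "card {v \<in> V. x v \<notin> {0, 1}}" arbitrary: x rule: less_induct)
  case less
  define F where "F = {v \<in> V. x v \<notin> {0, 1}}"
  have F: "F \<subseteq> V" "finite F" using assms(1) by (auto simp: F_def)
  have Ffib: "{v \<in> V. g k v = b \<and> x v \<notin> {0, 1}} = {v \<in> F. g k v = b}" for k b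
    by (auto simp: F_def)
  show ?case
  proof (cases "F = {}")
    case True
    then have "\<forall>v\<in>V. x v \<in> {0, 1}" by (auto simp: F_def)
    moreover have "\<forall>k\<in>K. \<forall>b. card {v \<in> V. g k v = b \<and> x v \<notin> {0, 1}} < L k"
      using True Lpos by (simp only: Ffib) simp
    ultimately show ?thesis using less.prems by (intro exI[of _ x]) blast
  next
    case False
    define H where "H = (\<lambda>k. {b \<in> g k ` F. L k \<le> card {v \<in> F. g k v = b}})"
    define C where "C = Sigma K H"
    have finH: "finite (H k)" for k using F by (simp add: H_def)
    have finC: "finite C" using assms(2) finH by (simp add: C_def)
    \<comment> \<open>Each family has at most \<open>card F / L k\<close> enforced constraints, so
      \<open>Lsum\<close> leaves fewer equations than unknowns.\<close>
    have "real (card C) = (\<Sum>k\<in>K. real (card (H k)))"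
      using assms(2) finH by (simp add: C_def)
    also have "\<dots> \<le> (\<Sum>k\<in>K. real (card F) * (1 / real (L k)))"
    proof (intro sum_mono)
      fix k assume k: "k \<in> K"
      have "real (L k * card (H k)) \<le> real (card F)"
        using card_heavy_fibres[OF F(2), of "L k" "g k"] by (simp add: H_def del: of_nat_mult)
      then show "real (card (H k)) \<le> real (card F) * (1 / real (L k))"
        using Lpos[OF k] by (simp add: field_simps)
    qed
    also have "\<dots> = real (card F) * (\<Sum>k\<in>K. 1 / real (L k))"
      by (simp add: sum_distrib_left)
    also have "\<dots> < real (card F) * 1"
      using False F Lsum by (intro mult_strict_left_mono) (auto simp: card_gt_0_iff)
    finally have "card C < card F" by simp
    from homogeneous_system_nontrivial_solution[OF finC F(2) this,
          of "\<lambda>c v. if g (fst c) v = snd c then s (fst c) v else 0"]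
    obtain z where z: "\<exists>v\<in>F. z v \<noteq> 0"
      and z': "\<forall>c\<in>C. (\<Sum>v\<in>F. (if g (fst c) v = snd c then s (fst c) v else 0) * z v) = 0"
      by (elim exE conjE) rule
    have zC: "(\<Sum>v\<in>F. (if g k v = b then s k v else 0) * z v) = 0" if "(k, b) \<in> C" for k b
      using bspec[OF z' that] by (simp only: fst_conv snd_conv)
    have xF: "0 < x v \<and> x v < 1" if "v \<in> F" for v
      using less.prems[of v] that by (auto simp: F_def less_le)
    obtain r where r: "\<And>v. v \<in> F \<Longrightarrow> 0 \<le> x v + r * z v \<and> x v + r * z v \<le> 1"
      and hit: "\<exists>v\<in>F. x v + r * z v \<in> {0, 1}"
      using move_until_integral[where x = x, OF F(2) xF z] by blast
    define x1 where "x1 = (\<lambda>v. if v \<in> F then x v + r * z v else x v)"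
    have x1: "0 \<le> x1 v \<and> x1 v \<le> 1" if "v \<in> V" for v
      using r less.prems that by (auto simp: x1_def)
    have x1F: "x1 v = x v" if "v \<in> V" "x v \<in> {0, 1}" for v
      using that by (auto simp: x1_def F_def)
    have "{v \<in> V. x1 v \<notin> {0, 1}} \<subset> F"
    proof -
      obtain u where "u \<in> F" "x1 u \<in> {0, 1}" using hit by (auto simp: x1_def)
      moreover have "{v \<in> V. x1 v \<notin> {0, 1}} \<subseteq> F" using x1F by (auto simp: F_def)
      ultimately show ?thesis by blast
    qed
    then have "card {v \<in> V. x1 v \<notin> {0, 1}} < card F" using F by (intro psubset_card_mono)
    from less.hyps[OF this[unfolded F_def] x1] obtain y where
      y: "\<forall>v\<in>V. y v \<in> {0, 1} \<and> (x1 v \<in> {0, 1} \<longrightarrow> y v = x1 v)"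
      and y': "\<And>k b. k \<in> K \<Longrightarrow>
        \<exists>x'. (\<forall>v\<in>V. 0 \<le> x' v \<and> x' v \<le> 1 \<and> (x' v \<in> {0, 1} \<longrightarrow> y v = x' v)) \<and>
        (\<Sum>v | v \<in> V \<and> g k v = b. s k v * x' v) = (\<Sum>v | v \<in> V \<and> g k v = b. s k v * x1 v) \<and>
        card {v \<in> V. g k v = b \<and> x' v \<notin> {0, 1}} < L k"
      by blast
    have yx: "\<forall>v\<in>V. y v \<in> {0, 1} \<and> (x v \<in> {0, 1} \<longrightarrow> y v = x v)"
      using y x1F by metis
    have "\<exists>x'. (\<forall>v\<in>V. 0 \<le> x' v \<and> x' v \<le> 1 \<and> (x' v \<in> {0, 1} \<longrightarrow> y v = x' v)) \<and>
        (\<Sum>v | v \<in> V \<and> g k v = b. s k v * x' v) = (\<Sum>v | v \<in> V \<and> g k v = b. s k v * x v) \<and>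
        card {v \<in> V. g k v = b \<and> x' v \<notin> {0, 1}} < L k" if k: "k \<in> K" for k b
    proof (cases "(k, b) \<in> C")
      case True
      \<comment> \<open>The direction \<open>z\<close> lies in the kernel, so moving from
        \<open>x\<close> to \<open>x1\<close> preserves the sum of an enforced group, and the
        witness for \<open>x1\<close> also serves \<open>x\<close>.\<close>
      have "(\<Sum>v | v \<in> V \<and> g k v = b. s k v * x1 v)
          = (\<Sum>v | v \<in> V \<and> g k v = b. s k v * x v + (if v \<in> F then r * (s k v * z v) else 0))"
        by (intro sum.cong) (auto simp: x1_def algebra_simps)
      also have "\<dots> = (\<Sum>v | v \<in> V \<and> g k v = b. s k v * x v)
          + (\<Sum>v | v \<in> V \<and> g k v = b. if v \<in> F then r * (s k v * z v) else 0)"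
        by (rule sum.distrib)
      also have "(\<Sum>v | v \<in> V \<and> g k v = b. if v \<in> F then r * (s k v * z v) else 0)
          = (\<Sum>v\<in>F. r * ((if g k v = b then s k v else 0) * z v))"
        using F assms(1) by (intro sum.mono_neutral_cong) auto
      also have "\<dots> = 0" using zC[OF True] by (simp flip: sum_distrib_left)
      finally show ?thesis using y'[OF k, of b] by simp
    next
      case nC: False
      \<comment> \<open>A group too small to be enforced is dropped now, so \<open>x\<close> itself
        is the witness.\<close>
      have "card {v \<in> F. g k v = b} < L k"
      proof (cases "b \<in> g k ` F")
        case True
        then show ?thesis using nC k by (auto simp: C_def H_def)
      next
        case False
        then have none: "{v \<in> F. g k v = b} = {}" by auto
        show ?thesis unfolding none using Lpos[OF k] by simp
      qed
      then show ?thesis using yx less.prems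
        by (intro exI[of _ x]) (auto simp only: Ffib)
    qed
    then show ?thesis using yx by blast
  qed
qed

text \<open>After the state \<open>x'\<close>, fewer than \<open>L k\<close> variables of the group
  still change, each by less than 1 because it is strictly fractional there. The case
  \<open>e = 0\<close> is separate because the strict bound fails when \<open>U k = 0\<close> or
  \<open>L k = 1\<close>.\<close>

lemma beck_fiala_rounding:
  fixes x :: "'v \<Rightarrow> real" and s :: "'k \<Rightarrow> 'v \<Rightarrow> real" and g :: "'k \<Rightarrow> 'v \<Rightarrow> 'b" and L :: "'k \<Rightarrow> nat"
  assumes "finite V" "finite K" "\<And>k. k \<in> K \<Longrightarrow> 0 < L k"
    and "(\<Sum>k\<in>K. 1 / real (L k)) < 1"
    and "\<And>v. v \<in> V \<Longrightarrow> 0 \<le> x v \<and> x v \<le> 1"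
    and s: "\<And>k v. k \<in> K \<Longrightarrow> v \<in> V \<Longrightarrow> \<bar>s k v\<bar> \<le> U k"
  obtains y where "\<And>v. v \<in> V \<Longrightarrow> y v \<in> {0, 1}"
    and "\<And>k b e. k \<in> K \<Longrightarrow>
      e = (\<Sum>v | v \<in> V \<and> g k v = b. s k v * y v) - (\<Sum>v | v \<in> V \<and> g k v = b. s k v * x v) \<Longrightarrow>
      e = 0 \<or> \<bar>e\<bar> < (real (L k) - 1) * U k"
proof -
  note rounding = iterated_rounding[where V = V and K = K and L = L and x = x and g = g and s = s,
      OF assms(1-5)]
  obtain y where Y: "(\<forall>v\<in>V. y v \<in> {0, 1} \<and> (x v \<in> {0, 1} \<longrightarrow> y v = x v)) \<and>
      (\<forall>k\<in>K. \<forall>b. \<exists>x'. (\<forall>v\<in>V. 0 \<le> x' v \<and> x' v \<le> 1 \<and> (x' v \<in> {0, 1} \<longrightarrow> y v = x' v)) \<and>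
        (\<Sum>v | v \<in> V \<and> g k v = b. s k v * x' v) = (\<Sum>v | v \<in> V \<and> g k v = b. s k v * x v) \<and>
        card {v \<in> V. g k v = b \<and> x' v \<notin> {0, 1}} < L k)"
    by (rule exE[OF rounding])
  have y: "y v \<in> {0, 1}" if "v \<in> V" for v using Y that by (elim conjE) blast
  note y' = bspec[OF conjunct2[OF Y], THEN spec]
  show thesis
  proof (rule that)
    fix k b e
    assume k: "k \<in> K"
      and e: "e = (\<Sum>v | v \<in> V \<and> g k v = b. s k v * y v) - (\<Sum>v | v \<in> V \<and> g k v = b. s k v * x v)"
    obtain x' where x': "\<forall>v\<in>V. 0 \<le> x' v \<and> x' v \<le> 1 \<and> (x' v \<in> {0, 1} \<longrightarrow> y v = x' v)"
      and eq: "(\<Sum>v | v \<in> V \<and> g k v = b. s k v * x' v) = (\<Sum>v | v \<in> V \<and> g k v = b. s k v * x v)"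
      and cd: "card {v \<in> V. g k v = b \<and> x' v \<notin> {0, 1}} < L k"
      using y'[OF k, of b] by (elim exE conjE) rule
    define W where "W = {v \<in> V. g k v = b \<and> x' v \<notin> {0, 1}}"
    have W: "finite W" "W \<subseteq> V" using assms(1) by (auto simp: W_def)
    have "e = (\<Sum>v | v \<in> V \<and> g k v = b. s k v * (y v - x' v))"
      by (simp add: e eq right_diff_distrib sum_subtractf)
    also have "\<dots> = (\<Sum>v\<in>W. s k v * (y v - x' v))"
      using assms(1) x' by (intro sum.mono_neutral_right) (auto simp: W_def)
    finally have e': "e = (\<Sum>v\<in>W. s k v * (y v - x' v))" .
    have d: "\<bar>y v - x' v\<bar> < 1" if "v \<in> W" for v
    proof -
      have "0 \<le> x' v" "x' v \<le> 1" "x' v \<noteq> 0" "x' v \<noteq> 1" "y v = 0 \<or> y v = 1"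
        using that x' y by (auto simp: W_def)
      then show ?thesis by auto
    qed
    consider "W = {}" | "U k \<le> 0" | "W \<noteq> {}" "U k > 0" by linarith
    then show "e = 0 \<or> \<bar>e\<bar> < (real (L k) - 1) * U k"
    proof cases
      case 2
      have "s k v = 0" if "v \<in> W" for v using s[OF k, of v] that W 2 by fastforce
      then show ?thesis by (simp add: e')
    next
      case 3
      have "\<bar>e\<bar> \<le> (\<Sum>v\<in>W. \<bar>s k v * (y v - x' v)\<bar>)" unfolding e' by (rule sum_abs)
      also have "\<dots> < (\<Sum>v\<in>W. U k)"
      proof (intro sum_strict_mono)
        fix v assume v: "v \<in> W"
        have "\<bar>s k v * (y v - x' v)\<bar> \<le> U k * \<bar>y v - x' v\<bar>"
          unfolding abs_mult using s[OF k, of v] v W by (intro mult_right_mono) auto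
        also have "\<dots> < U k * 1" using d[OF v] 3 by (intro mult_strict_left_mono) auto
        finally show "\<bar>s k v * (y v - x' v)\<bar> < U k" by simp
      qed (use W 3 in auto)
      also have "\<dots> \<le> (real (L k) - 1) * U k"
        using cd 3 by (auto simp: W_def intro!: mult_right_mono)
      finally show ?thesis by simp
    qed (simp add: e')
  qed (use y in auto)
qed

section \<open>Rounding a fractional assignment of jobs to machines\<close>

text \<open>Every job is given the share \<open>w i\<close> on machine \<open>i\<close>, and this is
  rounded. The additive errors are the threshold minus 1 times the largest entry: 6 = 7 - 1 for the
  two loads and 4 = 5 - 1 for the block counts.\<close>

lemma assignment_rounding:
  fixes w u q :: "nat \<Rightarrow> real" and blk :: "nat \<Rightarrow> nat"
  assumes "finite I" "finite J" and w: "\<And>i. i \<in> I \<Longrightarrow> 0 \<le> w i" "sum w I = 1"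
    and "0 \<le> U" "\<And>j. j \<in> J \<Longrightarrow> 0 \<le> u j \<and> u j \<le> U"
    and "0 \<le> Q" "\<And>j. j \<in> J \<Longrightarrow> 0 \<le> q j \<and> q j \<le> Q"
  obtains f where "f \<in> J \<rightarrow> I"
    and "\<And>i. i \<in> I \<Longrightarrow> (\<Sum>j | j \<in> J \<and> f j = i. u j) \<le> w i * sum u J + 6 * U"
    and "\<And>i. i \<in> I \<Longrightarrow> (\<Sum>j | j \<in> J \<and> f j = i. q j) \<le> w i * sum q J + 6 * Q"
    and "\<And>i t. i \<in> I \<Longrightarrow>
      real (card {j \<in> J. f j = i \<and> blk j = t}) \<le> w i * real (card {j \<in> J. blk j = t}) + 4"
proof -
  \<comment> \<open>The families are: jobs, pairs of a machine and a block, and the two loads of a machine. The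
    thresholds satisfy \<open>1/2 + 1/5 + 1/7 + 1/7 < 1\<close>. Threshold 2 for the jobs forces the rounded
    shares of a job, an integer at distance less than 1 from 1, to add up to exactly 1.\<close>
  define K where "K = {0, 1, 2, 3 :: nat}"
  define L :: "nat \<Rightarrow> nat" where "L = (\<lambda>k. [2, 5, 7, 7] ! k)"
  define s :: "nat \<Rightarrow> nat \<times> nat \<Rightarrow> real" where "s = (\<lambda>k v. [1, 1, u (snd v), q (snd v)] ! k)"
  \<comment> \<open>A single key type serves all families; coordinates irrelevant to a family are
    filled with 0.\<close>
  define g :: "nat \<Rightarrow> nat \<times> nat \<Rightarrow> nat \<times> nat"
    where "g = (\<lambda>k v. [(0, snd v), (fst v, blk (snd v)), (fst v, 0), (fst v, 0)] ! k)"
  define B where "B = (\<lambda>k. [1, 1, U, Q] ! k)"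
  have w1: "w i \<le> 1" if "i \<in> I" for i
    using member_le_sum[of i I w] w that assms(1) by auto
  obtain y where y: "\<And>v. v \<in> I \<times> J \<Longrightarrow> y v \<in> {0, 1}"
    and err: "\<And>k b e. k \<in> K \<Longrightarrow>
      e = (\<Sum>v | v \<in> I \<times> J \<and> g k v = b. s k v * y v)
        - (\<Sum>v | v \<in> I \<times> J \<and> g k v = b. s k v * w (fst v)) \<Longrightarrow>
      e = 0 \<or> \<bar>e\<bar> < (real (L k) - 1) * B k"
  proof (rule beck_fiala_rounding[where V = "I \<times> J" and K = K and L = L and s = s and g = g
      and U = B and x = "\<lambda>v. w (fst v)"])
    show "\<bar>s k v\<bar> \<le> B k" if "k \<in> K" "v \<in> I \<times> J" for k v
      using that assms by (auto simp: K_def s_def B_def)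
  qed (use assms w1 in \<open>auto simp: K_def L_def\<close>)
  have row: "(\<Sum>v | v \<in> I \<times> J \<and> fst v = i \<and> P (snd v). h v) = (\<Sum>j | j \<in> J \<and> P j. h (i, j))"
    if "i \<in> I" for i P and h :: "nat \<times> nat \<Rightarrow> real"
    using that by (intro sum.reindex_bij_witness[of _ "Pair i" snd]) auto
  have y1: "\<exists>!i. i \<in> I \<and> y (i, j) = 1" if j: "j \<in> J" for j
  proof -
    have col: "(\<Sum>v | v \<in> I \<times> J \<and> snd v = j. h v) = (\<Sum>i\<in>I. h (i, j))" for h :: "nat \<times> nat \<Rightarrow> real"
      using j by (intro sum.reindex_bij_witness[of _ "\<lambda>i. (i, j)" fst]) auto
    have "(\<Sum>i\<in>I. y (i, j)) = (\<Sum>i\<in>I. if y (i, j) = 1 then 1 else 0)"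
      using y j by (intro sum.cong) auto
    also have "\<dots> = real (card {i \<in> I. y (i, j) = 1})"
      using assms(1) by (simp add: sum.If_cases Int_def)
    finally have c: "(\<Sum>i\<in>I. y (i, j)) = real (card {i \<in> I. y (i, j) = 1})" .
    have "real (card {i \<in> I. y (i, j) = 1}) - 1 = 0 \<or> \<bar>real (card {i \<in> I. y (i, j) = 1}) - 1\<bar> < 1"
      using err[of 0 _ "(0, j)"] by (simp add: K_def L_def g_def s_def B_def col c w)
    then have "card {i \<in> I. y (i, j) = 1} = 1" by linarith
    then obtain i0 where "{i \<in> I. y (i, j) = 1} = {i0}" by (rule card_1_singletonE)
    then show ?thesis by (intro ex1I[of _ i0]) auto
  qed
  define f where "f = (\<lambda>j. THE i. i \<in> I \<and> y (i, j) = 1)"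
  have fI: "f j \<in> I" and fy: "y (f j, j) = 1" if "j \<in> J" for j
    using theI'[OF y1[OF that]] by (auto simp: f_def)
  have yf: "y (i, j) = (if f j = i then 1 else 0)" if "i \<in> I" "j \<in> J" for i j
    using y[of "(i, j)"] y1[OF that(2)] fI[OF that(2)] fy[OF that(2)] that by auto
  have load: "(\<Sum>j | j \<in> J \<and> P j. h j * y (i, j)) = (\<Sum>j | j \<in> J \<and> f j = i \<and> P j. h j)"
    if "i \<in> I" for i P and h :: "nat \<Rightarrow> real"
    using assms(2) that by (intro sum.mono_neutral_cong_right) (auto simp: yf)
  show thesis
  proof (rule that)
    show "f \<in> J \<rightarrow> I" using fI by auto
  next
    fix i assume i: "i \<in> I"
    show "(\<Sum>j | j \<in> J \<and> f j = i. u j) \<le> w i * sum u J + 6 * U"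
      using err[of 2 _ "(i, 0)"] row[OF i, where P = "\<lambda>_. True"] load[OF i, where h = u and P = "\<lambda>_. True"] assms(5)
      by (auto simp add: K_def L_def g_def s_def B_def mult.commute simp flip: sum_distrib_left)
    show "(\<Sum>j | j \<in> J \<and> f j = i. q j) \<le> w i * sum q J + 6 * Q"
      using err[of 3 _ "(i, 0)"] row[OF i, where P = "\<lambda>_. True"] load[OF i, where h = q and P = "\<lambda>_. True"] assms(7)
      by (auto simp add: K_def L_def g_def s_def B_def mult.commute simp flip: sum_distrib_left)
    fix t
    show "real (card {j \<in> J. f j = i \<and> blk j = t}) \<le> w i * real (card {j \<in> J. blk j = t}) + 4"
      using err[of 1 _ "(i, t)"] row[OF i, where P = "\<lambda>j. blk j = t"]
        row[OF i, where P = "\<lambda>j. blk j = t" and h = "\<lambda>_. 1"]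
        load[OF i, where h = "\<lambda>_. 1" and P = "\<lambda>j. blk j = t"]
      by (auto simp add: K_def L_def g_def s_def B_def mult.commute)
  qed
qed

section \<open>Blocks of jobs in order of deviation\<close>

text \<open>Jobs are ranked by decreasing \<open>d\<close>, and the block of a job is its rank
  divided by \<open>m\<close>, rounded down. The last block may be incomplete, so fullness is
  claimed only for a block with a nonempty successor.\<close>

lemma exists_monotone_blocks:
  fixes d :: "'a \<Rightarrow> real"
  assumes "finite J" "m \<ge> 1"
  obtains blk :: "'a \<Rightarrow> nat" where "\<And>t. card {j \<in> J. blk j = t} \<le> m"
    and "\<And>j t. j \<in> J \<Longrightarrow> blk j = Suc t \<Longrightarrow> card {i \<in> J. blk i = t} = m"
    and "\<And>i j. i \<in> J \<Longrightarrow> j \<in> J \<Longrightarrow> blk i < blk j \<Longrightarrow> d j \<le> d i"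
proof -
  obtain ys where ys: "set ys = J" "distinct ys" using finite_distinct_list[OF assms(1)] by blast
  define xs where "xs = sort_key (\<lambda>j. - d j) ys"
  have xs: "set xs = J" "distinct xs" "sorted (map (\<lambda>j. - d j) xs)"
    using ys by (auto simp: xs_def)
  define N where "N = length xs"
  have bij: "bij_betw ((!) xs) {..<N} J"
    using xs by (intro bij_betw_nth) (auto simp: N_def)
  define r where "r = the_inv_into {..<N} ((!) xs)"
  have rb: "bij_betw r J {..<N}" unfolding r_def by (rule bij_betw_the_inv_into[OF bij])
  have xr: "xs ! r j = j" if "j \<in> J" for j
    using f_the_inv_into_f_bij_betw[OF bij, of j] that by (simp add: r_def)
  have block: "card {j \<in> J. r j div m = t} = card {a. a < N \<and> a div m = t}" for t
  proof (rule bij_betw_same_card[of r])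
    show "bij_betw r {j \<in> J. r j div m = t} {a. a < N \<and> a div m = t}"
      using rb unfolding bij_betw_def by (auto intro: inj_on_subset)
  qed
  have div: "a div m = t \<longleftrightarrow> a \<in> {t * m..<Suc t * m}" for a t
    using assms(2) div_less_iff_less_mult[of m a "Suc t"] less_eq_div_iff_mult_less_eq[of m t a] by auto
  show thesis
  proof (rule that[of "\<lambda>j. r j div m"])
    fix t
    have "{a. a < N \<and> a div m = t} \<subseteq> {t * m..<Suc t * m}" using div by auto
    then have "card {a. a < N \<and> a div m = t} \<le> card {t * m..<Suc t * m}" by (intro card_mono) auto
    then show "card {j \<in> J. r j div m = t} \<le> m" by (simp add: block)
  next
    fix j t assume j: "j \<in> J" "r j div m = Suc t"
    \<comment> \<open>A rank in block \<open>Suc t\<close> is at least \<open>Suc t * m\<close>, so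
      all \<open>m\<close> ranks of block \<open>t\<close> lie below it and hence below
      \<open>N\<close>.\<close>
    then have "Suc t * m \<le> r j" using div[of "r j" "Suc t"] by simp
    moreover have "r j < N" using rb j by (auto simp: bij_betw_def)
    ultimately have "{a. a < N \<and> a div m = t} = {t * m..<Suc t * m}" using div by auto
    then show "card {i \<in> J. r i div m = t} = m" by (simp add: block)
  next
    fix i j assume ij: "i \<in> J" "j \<in> J" "r i div m < r j div m"
    then have "r i \<le> r j" using div_le_mono[of "r j" "r i" m] by linarith
    moreover have "r j < length xs" using rb ij by (auto simp: bij_betw_def N_def)
    ultimately have "map (\<lambda>j. - d j) xs ! r i \<le> map (\<lambda>j. - d j) xs ! r j"
      using xs(3) by (intro sorted_nth_mono) auto
    then show "d j \<le> d i" using \<open>r i \<le> r j\<close> \<open>r j < length xs\<close> by (simp add: xr ij)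
  qed
qed

text \<open>A value in block \<open>Suc t\<close> is at most every value in the full block
  \<open>t\<close>, hence at most their average. Charging each block to its predecessor leaves only
  block 0 to be bounded by \<open>M\<close>.\<close>

lemma sum_le_of_few_per_block:
  fixes g :: "'a \<Rightarrow> real" and blk :: "'a \<Rightarrow> nat"
  assumes "finite J" "m \<ge> 1" "A \<subseteq> J"
    and full: "\<And>j t. j \<in> J \<Longrightarrow> blk j = Suc t \<Longrightarrow> card {i \<in> J. blk i = t} = m"
    and mono: "\<And>i j. i \<in> J \<Longrightarrow> j \<in> J \<Longrightarrow> blk i < blk j \<Longrightarrow> g j \<le> g i"
    and g: "\<And>j. j \<in> J \<Longrightarrow> 0 \<le> g j \<and> g j \<le> M" and "0 \<le> M"
    and few: "\<And>t. real (card {j \<in> A. blk j = t}) \<le> c"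
  shows "sum g A \<le> c * (M + sum g J / m)"
proof -
  have c0: "0 \<le> c" using few[of 0] of_nat_0_le_iff order_trans by blast
  have finA: "finite A" using assms(1,3) by (rule finite_subset[rotated])
  obtain n where "blk ` J \<subseteq> {..<n}" using finite_nat_bounded assms(1) by blast
  then have n: "blk j < n" if "j \<in> J" for j using that by auto
  define H where "H = (\<lambda>t. \<Sum>j | j \<in> J \<and> blk j = t. g j)"
  have H0: "0 \<le> H t" for t unfolding H_def using g by (intro sum_nonneg) auto
  have bound: "(\<Sum>j | j \<in> A \<and> blk j = t. g j) \<le> c * b" if "0 \<le> b" "\<And>j. j \<in> J \<Longrightarrow> blk j = t \<Longrightarrow> g j \<le> b" for t b
  proof -
    have "(\<Sum>j | j \<in> A \<and> blk j = t. g j) \<le> (\<Sum>j | j \<in> A \<and> blk j = t. b)"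
      using that assms(3) by (intro sum_mono) auto
    also have "\<dots> \<le> c * b" using few[of t] that(1) by (simp add: mult_right_mono)
    finally show ?thesis .
  qed
  have Suc: "g j \<le> H t / m" if j: "j \<in> J" "blk j = Suc t" for j t
  proof -
    have "m * g j = (\<Sum>i | i \<in> J \<and> blk i = t. g j)" using full[OF j] by simp
    also have "\<dots> \<le> H t" unfolding H_def using mono j by (intro sum_mono) auto
    finally show ?thesis using assms(2) by (simp add: field_simps)
  qed
  \<comment> \<open>The range includes the empty block \<open>n\<close>: once block 0 is split off,
    the remaining blocks are charged to exactly the blocks below \<open>n\<close>, which together
    form \<open>J\<close>.\<close>
  have "sum g A = (\<Sum>t<Suc n. \<Sum>j | j \<in> A \<and> blk j = t. g j)"
    using less_SucI[OF n] assms(3) by (intro sum.group[symmetric] finA) auto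
  also have "\<dots> = (\<Sum>j | j \<in> A \<and> blk j = 0. g j) + (\<Sum>t<n. \<Sum>j | j \<in> A \<and> blk j = Suc t. g j)"
    by (rule sum.lessThan_Suc_shift)
  also have "\<dots> \<le> c * M + (\<Sum>t<n. c * (H t / m))"
    using g Suc H0 \<open>0 \<le> M\<close> by (intro add_mono sum_mono bound) auto
  also have "\<dots> = c * (M + (\<Sum>t<n. H t) / m)"
    by (simp add: sum_distrib_left sum_divide_distrib distrib_left)
  also have "(\<Sum>t<n. H t) = sum g J"
    unfolding H_def using n assms(1) by (intro sum.group) auto
  finally show ?thesis .
qed

section \<open>Loads of schedules and lower bounds on the robust optimum\<close>

lemma sum_schedule:
  assumes "S \<in> schedules m n"
  shows "(\<Sum>i\<in>{1..m}. \<Sum>j\<in>S i. h j) = (\<Sum>j\<in>{1..n}. h j)"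
proof -
  have S: "S \<in> {1..m} \<rightarrow> Pow {1..n}" "disjoint_family_on S {1..m}" "(\<Union>i\<in>{1..m}. S i) = {1..n}"
    using assms by (auto simp: schedules_def)
  have "sum h (\<Union>i\<in>{1..m}. S i) = (\<Sum>i\<in>{1..m}. \<Sum>j\<in>S i. h j)"
    using S(1,2) by (intro sum.UNION_disjoint) (auto simp: disjoint_family_on_def intro: finite_subset)
  then show ?thesis using S(3) by simp
qed

lemma load_le_Cmax: "i \<in> {1..m} \<Longrightarrow> (\<Sum>j\<in>S i. p j) \<le> Cmax m S p"
  unfolding Cmax_def by (intro Max_ge) auto

lemma Cmax_leI: "m \<ge> 1 \<Longrightarrow> (\<And>i. i \<in> {1..m} \<Longrightarrow> (\<Sum>j\<in>S i. p j) \<le> c) \<Longrightarrow> Cmax m S p \<le> c"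
  unfolding Cmax_def by (subst Max_le_iff) auto

lemma scenarios_nonneg: "p \<in> scenarios n \<Longrightarrow> j \<in> {1..n} \<Longrightarrow> 0 \<le> p j"
  by (auto simp: scenarios_def)

lemma schedule_subset: "S \<in> schedules m n \<Longrightarrow> i \<in> {1..m} \<Longrightarrow> S i \<subseteq> {1..n}"
  by (auto simp: schedules_def)

lemma schedule_covers: "S \<in> schedules m n \<Longrightarrow> j \<in> {1..n} \<Longrightarrow> \<exists>i\<in>{1..m}. j \<in> S i"
  unfolding schedules_def by blast

text \<open>All three bounds come from attacking one machine of an optimal robust schedule:
  \<open>attack\<close> is applied to a single job, to no job, and to jobs of deviation above
  \<open>R / \<Gamma>\<close>.\<close>

lemma robust_optimum_bounds:
  assumes m: "m \<ge> 1" and sc: "pl \<in> scenarios n" "pu \<in> scenarios n"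
    and le: "\<forall>j\<in>{1..n}. pl j \<le> pu j" and G: "\<Gamma> \<in> {1..n}"
    and R: "R = OPT_rob m n (budget_set n pl pu \<Gamma>)"
  shows "\<And>j. j \<in> {1..n} \<Longrightarrow> pu j \<le> R"
    and "(\<Sum>j\<in>{1..n}. pl j) \<le> m * R"
    and "(\<Sum>j | j \<in> {1..n} \<and> pu j - pl j > R / \<Gamma>. pu j - pl j) \<le> m * R"
proof -
  let ?U = "budget_set n pl pu \<Gamma>"
  have "R \<in> (\<lambda>S. Cmax_worst m S ?U) ` schedules m n"
    unfolding R OPT_rob_def using finite_schedules schedules_nonempty[OF m] by (intro Min_in) auto
  then obtain S where S: "S \<in> schedules m n" "R = Cmax_worst m S ?U" by blast
  obtain p where "R = Cmax m S p" and worst: "\<And>q. q \<in> ?U \<Longrightarrow> Cmax m S q \<le> Cmax m S p"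
    using Cmax_worst_attained[OF m S(1) sc le] S(2) by metis
  then have URob: "Cmax m S q \<le> R" if "q \<in> ?U" for q using that by simp
  have S_sub: "S i \<subseteq> {1..n}" if "i \<in> {1..m}" for i using schedule_subset[OF S(1) that] .
  have attack: "(\<Sum>j\<in>S i. pl j) + (\<Sum>j\<in>T. pu j - pl j) \<le> R"
    if i: "i \<in> {1..m}" and T: "T \<subseteq> S i" "card T \<le> \<Gamma>" for i T
  proof -
    define q where "q = (\<lambda>j. if j \<in> T then pu j else pl j)"
    have Tn: "T \<subseteq> {1..n}" using T S_sub[OF i] by auto
    have "q \<in> scenarios n"
      using sc Tn unfolding scenarios_def by (auto simp: q_def PiE_iff extensional_def)
    then have "q \<in> ?U"
      unfolding budget_set_def using Tn T le by (auto simp: q_def intro!: exI[of _ T])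
    then have "(\<Sum>j\<in>S i. q j) \<le> R" using load_le_Cmax[OF i, of q S] URob[of q] by linarith
    moreover have "(\<Sum>j\<in>S i. q j) = (\<Sum>j\<in>S i. pl j + (if j \<in> T then pu j - pl j else 0))"
      by (intro sum.cong) (auto simp: q_def)
    moreover have "\<dots> = (\<Sum>j\<in>S i. pl j) + (\<Sum>j\<in>T. pu j - pl j)"
      using T(1) finite_subset[OF S_sub[OF i]]
      by (simp add: sum.distrib sum.inter_restrict[symmetric] Int_absorb1)
    ultimately show ?thesis by simp
  qed
  have nn: "0 \<le> (\<Sum>j\<in>S i. pl j)" if "i \<in> {1..m}" for i
    using S_sub[OF that] scenarios_nonneg[OF sc(1)] by (intro sum_nonneg) auto
  show "pu j \<le> R" if j: "j \<in> {1..n}" for j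
  proof -
    obtain i where i: "i \<in> {1..m}" "j \<in> S i" using schedule_covers[OF S(1) j] by blast
    have "pl j \<le> (\<Sum>j\<in>S i. pl j)"
      using i S_sub[OF i(1)] scenarios_nonneg[OF sc(1)] finite_subset[OF S_sub[OF i(1)]]
      by (intro member_le_sum) auto
    then show ?thesis using attack[OF i(1), of "{j}"] i G by auto
  qed
  have "(\<Sum>j\<in>{1..n}. pl j) = (\<Sum>i\<in>{1..m}. \<Sum>j\<in>S i. pl j)" by (rule sum_schedule[OF S(1), symmetric])
  also have "\<dots> \<le> (\<Sum>i\<in>{1..m}. R)" using attack[of _ "{}"] by (intro sum_mono) auto
  finally show "(\<Sum>j\<in>{1..n}. pl j) \<le> m * R" by simp
  let ?d = "\<lambda>j. pu j - pl j"
  have big: "(\<Sum>j | j \<in> S i \<and> ?d j > R / \<Gamma>. ?d j) \<le> R" if i: "i \<in> {1..m}" for i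
  proof (cases "card {j \<in> S i. ?d j > R / \<Gamma>} \<le> \<Gamma>")
    case True
    have "{j \<in> S i. ?d j > R / \<Gamma>} \<subseteq> S i" by blast
    from attack[OF i this True] show ?thesis using nn[OF i] by linarith
  next
    case False
    \<comment> \<open>This case is contradictory: \<open>\<Gamma>\<close> deviations above
      \<open>R / \<Gamma>\<close> already add up to more than \<open>R\<close>.\<close>
    then obtain T where T: "T \<subseteq> {j \<in> S i. ?d j > R / \<Gamma>}" "card T = \<Gamma>"
      using obtain_subset_with_card_n[of \<Gamma> "{j \<in> S i. ?d j > R / \<Gamma>}"] nat_le_linear by blast
    have "(\<Sum>j\<in>T. R / \<Gamma>) < (\<Sum>j\<in>T. ?d j)"
      using T G by (intro sum_strict_mono) (auto intro: card_ge_0_finite)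
    then have "R < (\<Sum>j\<in>T. ?d j)" using T(2) G by simp
    moreover have "T \<subseteq> S i" "card T \<le> \<Gamma>" using T by auto
    ultimately show ?thesis using attack[OF i, of T] nn[OF i] by linarith
  qed
  have "(\<Sum>j | j \<in> {1..n} \<and> ?d j > R / \<Gamma>. ?d j) = (\<Sum>j\<in>{1..n}. if ?d j > R / \<Gamma> then ?d j else 0)"
    by (rule sum.inter_filter) simp
  also have "\<dots> = (\<Sum>i\<in>{1..m}. \<Sum>j\<in>S i. if ?d j > R / \<Gamma> then ?d j else 0)"
    by (rule sum_schedule[OF S(1), symmetric])
  also have "\<dots> = (\<Sum>i\<in>{1..m}. \<Sum>j | j \<in> S i \<and> ?d j > R / \<Gamma>. ?d j)"
    using finite_subset[OF S_sub] by (intro sum.cong sum.inter_filter[symmetric]) auto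
  also have "\<dots> \<le> (\<Sum>i\<in>{1..m}. R)" by (intro sum_mono big)
  finally show "(\<Sum>j | j \<in> {1..n} \<and> ?d j > R / \<Gamma>. ?d j) \<le> m * R" by simp
qed

text \<open>Every attacked job is charged \<open>R / \<Gamma>\<close>, and every job above that
  threshold its full deviation, attacked or not. The resulting bound does not depend on the attacked
  set.\<close>

lemma budget_load_le:
  fixes d :: "nat \<Rightarrow> real"
  assumes d: "d = (\<lambda>j. pu j - pl j)" and p: "p \<in> budget_set n pl pu \<Gamma>"
    and "\<Gamma> \<ge> 1" "0 \<le> R" "A \<subseteq> {1..n}" "\<And>j. j \<in> A \<Longrightarrow> pl j \<le> pu j"
  shows "(\<Sum>j\<in>A. p j) \<le> (\<Sum>j\<in>A. pl j) + R + (\<Sum>j | j \<in> A \<and> d j > R / \<Gamma>. d j)"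
proof -
  obtain T where T: "T \<subseteq> {1..n}" "card T \<le> \<Gamma>"
    "\<forall>j\<in>{1..n} - T. p j = pl j" "\<forall>j\<in>T. p j \<in> {pl j..pu j}"
    using p by (auto simp: budget_set_def)
  have finA: "finite A" and finT: "finite T" using assms(5) T(1) by (auto intro: finite_subset)
  have "(\<Sum>j\<in>A. p j) \<le> (\<Sum>j\<in>A. pl j + ((if j \<in> T then R / \<Gamma> else 0) + (if d j > R / \<Gamma> then d j else 0)))"
  proof (rule sum_mono)
    fix j assume j: "j \<in> A"
    then have le: "pl j \<le> pu j" and jn: "j \<in> {1..n}" using assms by auto
    show "p j \<le> pl j + ((if j \<in> T then R / \<Gamma> else 0) + (if d j > R / \<Gamma> then d j else 0))"
    proof (cases "j \<in> T")
      case True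
      then have "p j \<le> pl j + d j" using T(4) by (simp add: d)
      moreover have "0 \<le> R / \<Gamma>" using assms(4) by simp
      ultimately show ?thesis using True by simp
    next
      case False
      then show ?thesis using T(3) jn le by (simp add: d)
    qed
  qed
  also have "\<dots> = (\<Sum>j\<in>A. pl j) + ((\<Sum>j\<in>A. if j \<in> T then R / \<Gamma> else 0)
      + (\<Sum>j\<in>A. if d j > R / \<Gamma> then d j else 0))"
    by (simp only: sum.distrib)
  also have "\<dots> = (\<Sum>j\<in>A. pl j) + (\<Sum>j\<in>A \<inter> T. R / \<Gamma>) + (\<Sum>j | j \<in> A \<and> d j > R / \<Gamma>. d j)"
    by (simp only: sum.inter_restrict[OF finA] sum.inter_filter[OF finA] add.assoc)
  also have "(\<Sum>j\<in>A \<inter> T. R / \<Gamma>) \<le> R"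
  proof -
    have "card (A \<inter> T) \<le> \<Gamma>" using card_mono[OF finT, of "A \<inter> T"] T(2) by auto
    then have "real (card (A \<inter> T)) * (R / \<Gamma>) \<le> real \<Gamma> * (R / \<Gamma>)"
      using assms(4) by (intro mult_right_mono) auto
    then show ?thesis using assms(3) by simp
  qed
  finally show ?thesis by simp
qed

section \<open>Construction of the consistent and robust schedule\<close>

lemma exists_consistent_robust_schedule:
  fixes lam :: real
  assumes lam: "lam > 0" and m: "m \<ge> 1"
    and sc: "pl \<in> scenarios n" "pu \<in> scenarios n" "ph \<in> scenarios n"
    and le: "\<forall>j\<in>{1..n}. pl j \<le> pu j" and pred: "\<forall>j\<in>{1..n}. pl j \<le> ph j \<and> ph j \<le> pu j"
  shows "\<exists>S \<in> schedules m n. Cmax m S ph \<le> (1 + 2 / lam) * OPT m n ph \<and>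
      (\<forall>\<Gamma>\<in>{1..n}. Cmax_worst m S (budget_set n pl pu \<Gamma>)
         \<le> (10 * lam + 20) * OPT_rob m n (budget_set n pl pu \<Gamma>))"
proof -
  define D where "D = OPT m n ph"
  define I where "I = {1..m}"
  have "D \<in> (\<lambda>S. Cmax m S ph) ` schedules m n"
    unfolding D_def OPT_def using finite_schedules schedules_nonempty[OF m] by (intro Min_in) auto
  then obtain S0 where S0: "S0 \<in> schedules m n" and DS0: "D = Cmax m S0 ph" by blast
  have S0_sub: "S0 i \<subseteq> {1..n}" if "i \<in> I" for i
    using schedule_subset[OF S0] that by (simp add: I_def)
  have fin0: "finite (S0 i)" if "i \<in> I" for i using finite_subset[OF S0_sub[OF that]] by simp
  note ph0 = scenarios_nonneg[OF sc(3)]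
  have D0: "0 \<le> D"
    using load_le_Cmax[of 1 m ph S0] m S0_sub[of 1] ph0 sum_nonneg[of "S0 1" ph]
    by (force simp: DS0 I_def)
  \<comment> \<open>The 6 matches the rounding error of six maximal small jobs:
    \<open>6 * (D / (6 * lam)) = D / lam\<close>, one of the two such terms allowed beyond
    \<open>D\<close>.\<close>
  define J where "J = {j \<in> {1..n}. ph j \<le> D / (6 * lam)}"
  define l where "l = (\<lambda>i. \<Sum>j\<in>S0 i - J. ph j)"
  define s where "s = (\<lambda>i. \<Sum>j\<in>S0 i \<inter> J. ph j)"
  define P where "P = (\<Sum>j\<in>J. ph j)"
  have J: "J \<subseteq> {1..n}" "finite J" by (auto simp: J_def)
  have ls: "l i + s i \<le> D" if "i \<in> I" for i
    using load_le_Cmax[of i m ph S0] that sum.Int_Diff[OF fin0[OF that], of ph J]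
    by (simp add: l_def s_def DS0 I_def)
  have l0: "0 \<le> l i" and s0: "0 \<le> s i" if "i \<in> I" for i
    using S0_sub[OF that] ph0 by (auto simp: l_def s_def intro!: sum_nonneg)
  have sP: "sum s I = P"
  proof -
    have "sum s I = (\<Sum>i\<in>{1..m}. \<Sum>j\<in>S0 i. if j \<in> J then ph j else 0)"
      unfolding s_def I_def using fin0 by (intro sum.cong sum.inter_restrict) (auto simp: I_def)
    also have "\<dots> = (\<Sum>j\<in>{1..n}. if j \<in> J then ph j else 0)" by (rule sum_schedule[OF S0])
    also have "\<dots> = P" using J by (simp add: P_def sum.inter_restrict[symmetric] Int_absorb1)
    finally show ?thesis .
  qed
  have Ppos: "0 < P" if "\<not> P \<le> m * D / lam"
  proof -
    have "0 \<le> m * D / lam" using D0 lam by simp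
    then show ?thesis using that by linarith
  qed
  define w where "w = (\<lambda>i. if P \<le> m * D / lam then 1 / m else s i / P)"
  have w: "0 \<le> w i" "w i * m \<le> 1 + lam" "l i + w i * P \<le> D + D / lam" if i: "i \<in> I" for i
  proof -
    show "0 \<le> w i" using s0[OF i] Ppos by (auto simp: w_def intro: divide_nonneg_pos)
    show "w i * m \<le> 1 + lam"
    proof (cases "P \<le> m * D / lam")
      case False
      \<comment> \<open>The small jobs exceed \<open>m * D / lam\<close> in total while
        \<open>s i\<close> is at most \<open>D\<close>, so proportional shares stay below
        \<open>lam / m\<close>.\<close>
      then have P: "m * D < lam * P" using lam by (simp add: field_simps)
      have "s i * m \<le> D * m" using ls[OF i] l0[OF i] by (intro mult_right_mono) auto
      then have "s i * m \<le> (1 + lam) * P" using P Ppos[OF False] by (simp add: algebra_simps)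
      then show ?thesis using False Ppos[OF False] by (simp add: w_def field_simps)
    qed (use m lam in \<open>simp add: w_def\<close>)
    \<comment> \<open>Uniform shares add at most \<open>D / lam\<close> to a machine; proportional
      shares reproduce \<open>s i\<close> exactly.\<close>
    show "l i + w i * P \<le> D + D / lam"
    proof (cases "P \<le> m * D / lam")
      case True
      then have "w i * P \<le> D / lam" using m lam by (simp add: w_def field_simps)
      then show ?thesis using ls[OF i] s0[OF i] by simp
    next
      case False
      have "w i * P = s i" using False Ppos[OF False] by (simp add: w_def)
      then show ?thesis using ls[OF i] D0 lam by (simp add: add_increasing2)
    qed
  qed
  have w1: "sum w I = 1"
  proof (cases "P \<le> m * D / lam")
    case False
    then show ?thesis using Ppos[OF False] sP by (simp add: w_def flip: sum_divide_distrib)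
  qed (use m in \<open>simp add: w_def I_def\<close>)
  define d where "d = (\<lambda>j. pu j - pl j)"
  have d0: "0 \<le> d j" if "j \<in> {1..n}" for j using le that by (auto simp: d_def)
  obtain blk :: "nat \<Rightarrow> nat" where blk: "\<And>t. card {j \<in> J. blk j = t} \<le> m"
    "\<And>j t. j \<in> J \<Longrightarrow> blk j = Suc t \<Longrightarrow> card {i \<in> J. blk i = t} = m"
    "\<And>i j. i \<in> J \<Longrightarrow> j \<in> J \<Longrightarrow> blk i < blk j \<Longrightarrow> d j \<le> d i"
    using exists_monotone_blocks[OF J(2) m] by blast
  \<comment> \<open>The schedule must not depend on \<open>\<Gamma>\<close>, so the rounding cannot
    refer to the robust optimum; \<open>M\<close> replaces it and is below it for every
    \<open>\<Gamma>\<close>. Inserting 0 covers an empty \<open>J\<close>.\<close>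
  define M where "M = Max (insert 0 (pl ` J))"
  have M: "0 \<le> M" "\<And>j. j \<in> J \<Longrightarrow> pl j \<le> M" using J by (auto simp: M_def)
  obtain f where f: "f \<in> J \<rightarrow> I"
    and fl: "\<And>i. i \<in> I \<Longrightarrow> (\<Sum>j | j \<in> J \<and> f j = i. pl j) \<le> w i * sum pl J + 6 * M"
    and fh: "\<And>i. i \<in> I \<Longrightarrow> (\<Sum>j | j \<in> J \<and> f j = i. ph j) \<le> w i * P + 6 * (D / (6 * lam))"
    and fb: "\<And>i t. i \<in> I \<Longrightarrow>
      real (card {j \<in> J. f j = i \<and> blk j = t}) \<le> w i * real (card {j \<in> J. blk j = t}) + 4"
  proof (rule assignment_rounding[of I J w M pl "D / (6 * lam)" ph blk])
    show "0 \<le> pl j \<and> pl j \<le> M" if "j \<in> J" for j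
      using scenarios_nonneg[OF sc(1), of j] M that J by auto
    show "0 \<le> ph j \<and> ph j \<le> D / (6 * lam)" if "j \<in> J" for j
      using ph0[of j] that J_def by auto
  qed (use J(2) w(1) w1 M(1) D0 lam in \<open>auto simp: I_def P_def\<close>)
  define A where "A = (\<lambda>i. {j \<in> J. f j = i})"
  define S where "S = restrict (\<lambda>i. (S0 i - J) \<union> A i) I"
  have S: "S \<in> schedules m n"
  proof -
    have "disjoint_family_on S I"
      unfolding disjoint_family_on_def
    proof (intro ballI impI)
      fix i k assume ik: "i \<in> I" "k \<in> I" "i \<noteq> k"
      have "disjoint_family_on S0 I" using S0 by (simp add: schedules_def I_def)
      then have "S0 i \<inter> S0 k = {}" using ik by (rule disjoint_family_onD)
      then show "S i \<inter> S k = {}" using ik by (auto simp: S_def A_def)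
    qed
    moreover have "(\<Union>i\<in>I. S i) = {1..n}"
    proof
      show "(\<Union>i\<in>I. S i) \<subseteq> {1..n}" using S0_sub J by (auto simp: S_def A_def)
      show "{1..n} \<subseteq> (\<Union>i\<in>I. S i)"
      proof
        fix j assume j: "j \<in> {1..n}"
        show "j \<in> (\<Union>i\<in>I. S i)"
        proof (cases "j \<in> J")
          case True
          then show ?thesis using f by (auto simp: S_def A_def)
        next
          case False
          obtain i where "i \<in> I" "j \<in> S0 i" using schedule_covers[OF S0 j] by (auto simp: I_def)
          then show ?thesis using False by (auto simp: S_def)
        qed
      qed
    qed
    moreover have "S \<in> I \<rightarrow>\<^sub>E Pow {1..n}" using S0_sub J by (fastforce simp: S_def A_def)
    ultimately show ?thesis by (simp add: schedules_def I_def)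
  qed
  have A: "A i \<subseteq> J" "finite (A i)" for i using J by (auto simp: A_def)
  have split: "(\<Sum>j\<in>S i. p j) = (\<Sum>j\<in>S0 i - J. p j) + (\<Sum>j\<in>A i. p j)"
    if "i \<in> I" for i and p :: "nat \<Rightarrow> real"
    using A[of i] fin0[OF that] that by (simp add: S_def) (intro sum.union_disjoint, auto)
  have "Cmax m S ph \<le> (1 + 2 / lam) * D"
  proof (rule Cmax_leI[OF m])
    fix i assume "i \<in> {1..m}"
    then have i: "i \<in> I" by (simp add: I_def)
    have "(\<Sum>j\<in>S i. ph j) \<le> l i + (w i * P + 6 * (D / (6 * lam)))"
      using fh[OF i] split[OF i, of ph] by (simp add: l_def A_def)
    also have "\<dots> \<le> D + D / lam + 6 * (D / (6 * lam))" using w(3)[OF i] by simp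
    also have "\<dots> = (1 + 2 / lam) * D" using lam by (simp add: field_simps)
    finally show "(\<Sum>j\<in>S i. ph j) \<le> (1 + 2 / lam) * D" .
  qed
  moreover have "Cmax_worst m S (budget_set n pl pu \<Gamma>)
      \<le> (10 * lam + 20) * OPT_rob m n (budget_set n pl pu \<Gamma>)" if G: "\<Gamma> \<in> {1..n}" for \<Gamma>
  proof -
    define R where "R = OPT_rob m n (budget_set n pl pu \<Gamma>)"
    note bounds = robust_optimum_bounds[OF m sc(1,2) le G R_def]
    \<comment> \<open>Job 1 exists because \<open>\<Gamma> \<in> {1..n}\<close> forces
      \<open>n\<close> to be positive.\<close>
    have R0: "0 \<le> R"
      using bounds(1)[of 1] scenarios_nonneg[OF sc(2), of 1] G by auto
    have MR: "M \<le> R"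
    proof -
      have "pl j \<le> R" if "j \<in> J" for j
      proof -
        have j: "j \<in> {1..n}" using that J(1) by blast
        then show ?thesis using bounds(1)[OF j] le by fastforce
      qed
      then show ?thesis using J(2) R0 by (simp add: M_def)
    qed
    obtain p where p: "p \<in> budget_set n pl pu \<Gamma>"
      and worst: "Cmax_worst m S (budget_set n pl pu \<Gamma>) = Cmax m S p"
      using Cmax_worst_attained[OF m S sc(1,2) le] by metis
    have ppu: "p j \<le> pu j" if "j \<in> {1..n}" for j
      using p that le by (fastforce simp: budget_set_def)
    have "Cmax m S p \<le> (10 * lam + 20) * R"
    proof (rule Cmax_leI[OF m])
      fix i assume "i \<in> {1..m}"
      then have i: "i \<in> I" by (simp add: I_def)
      have large: "(\<Sum>j\<in>S0 i - J. p j) \<le> 6 * lam * R"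
      proof -
        let ?k = "real (card (S0 i - J))"
        have k: "?k \<le> 6 * lam"
        proof (cases "S0 i - J = {}")
          case True
          show ?thesis unfolding True using lam by simp
        next
          case False
          \<comment> \<open>Each large job has predicted size above \<open>D / (6 * lam)\<close>,
            and their total on machine \<open>i\<close> is at most \<open>D\<close>. The strict
            inequality is impossible for \<open>D = 0\<close>, so \<open>D\<close> can be
            cancelled.\<close>
          have "?k * (D / (6 * lam)) < l i"
            unfolding l_def using False fin0[OF i] S0_sub[OF i]
            by (subst sum_constant[symmetric], intro sum_strict_mono) (auto simp: J_def)
          also have "\<dots> \<le> D" using ls[OF i] s0[OF i] by simp
          finally have "?k * D < 6 * lam * D" using lam by (simp add: field_simps)
          then show ?thesis using D0 by (simp add: mult_less_cancel_right)
        qed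
        have "(\<Sum>j\<in>S0 i - J. p j) \<le> (\<Sum>j\<in>S0 i - J. R)"
        proof (rule sum_mono)
          fix j assume "j \<in> S0 i - J"
          then have "j \<in> {1..n}" using S0_sub[OF i] by blast
          then show "p j \<le> R" using ppu[of j] bounds(1)[of j] by simp
        qed
        also have "\<dots> \<le> 6 * lam * R" using k R0 by (simp add: mult_right_mono)
        finally show ?thesis .
      qed
      have pl_load: "(\<Sum>j\<in>A i. pl j) \<le> (7 + lam) * R"
      proof -
        \<comment> \<open>The share \<open>w i\<close> of a total of at most \<open>m * R\<close>
          costs \<open>(1 + lam) * R\<close>; the rounding error \<open>6 * M\<close> costs at most
          \<open>6 * R\<close>.\<close>
        have "sum pl J \<le> sum pl {1..n}"
          using J scenarios_nonneg[OF sc(1)] by (intro sum_mono2) auto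
        then have "w i * sum pl J \<le> w i * (m * R)"
          using bounds(2) w(1)[OF i] by (intro mult_left_mono) auto
        also have "\<dots> \<le> (1 + lam) * R" using mult_right_mono[OF w(2)[OF i] R0] by (simp add: mult.assoc)
        finally show ?thesis using fl[OF i] MR by (simp add: A_def algebra_simps)
      qed
      \<comment> \<open>Cutting off at the threshold preserves the order by deviation, so the same
        blocks work for every \<open>\<Gamma>\<close>.\<close>
      define g where "g = (\<lambda>j. if d j > R / \<Gamma> then d j else 0)"
      have "sum g (A i) \<le> (5 + lam) * (R + sum g J / m)"
      proof (rule sum_le_of_few_per_block[OF J(2) m A(1) blk(2)])
        show "g j \<le> g i'" if "i' \<in> J" "j \<in> J" "blk i' < blk j" for i' j
          using blk(3)[OF that] d0[of i'] J that by (auto simp: g_def)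
        show "0 \<le> g j \<and> g j \<le> R" if "j \<in> J" for j
        proof -
          have j: "j \<in> {1..n}" using that J by auto
          show ?thesis
            using bounds(1)[OF j] d0[OF j] scenarios_nonneg[OF sc(1) j] R0 by (simp add: g_def d_def)
        qed
        fix t
        \<comment> \<open>A block has at most \<open>m\<close> jobs, so its fractional count on
          machine \<open>i\<close> is at most \<open>1 + lam\<close>; the rounding error 4 makes
          this \<open>5 + lam\<close>.\<close>
        have "real (card {j \<in> A i. blk j = t}) \<le> w i * real (card {j \<in> J. blk j = t}) + 4"
          using fb[OF i, of t] by (simp add: A_def conj_assoc)
        also have "w i * real (card {j \<in> J. blk j = t}) \<le> w i * m"
          using blk(1)[of t] w(1)[OF i] by (intro mult_left_mono) auto
        finally show "real (card {j \<in> A i. blk j = t}) \<le> 5 + lam" using w(2)[OF i] by simp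
      qed (use R0 in auto)
      also have "sum g J \<le> m * R"
      proof -
        have "sum g J \<le> sum g {1..n}" using J d0 by (intro sum_mono2) (auto simp: g_def)
        also have "\<dots> = (\<Sum>j | j \<in> {1..n} \<and> d j > R / \<Gamma>. d j)"
          unfolding g_def by (rule sum.inter_filter[symmetric]) simp
        also have "\<dots> \<le> m * R" using bounds(3) by (simp add: d_def)
        finally show ?thesis .
      qed
      finally have "sum g (A i) \<le> (5 + lam) * (R + m * R / m)"
        using lam by (simp add: divide_right_mono)
      then have dev: "(\<Sum>j | j \<in> A i \<and> d j > R / \<Gamma>. d j) \<le> (10 + 2 * lam) * R"
        using m A(2) by (simp add: g_def sum.inter_filter algebra_simps)
      have "(\<Sum>j\<in>A i. p j) \<le> (\<Sum>j\<in>A i. pl j) + R + (\<Sum>j | j \<in> A i \<and> d j > R / \<Gamma>. d j)"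
        using G R0 A(1) J le by (intro budget_load_le[OF d_def p]) auto
      \<comment> \<open>In units of \<open>R\<close>: \<open>6 * lam\<close> for large jobs,
        \<open>7 + lam\<close> for lower sizes, 1 for attacks below the threshold and
        \<open>10 + 2 * lam\<close> for deviations above it.\<close>
      then have "(\<Sum>j\<in>S i. p j) \<le> (9 * lam + 18) * R"
        using large pl_load dev split[OF i, of p] by (simp add: algebra_simps)
      also have "\<dots> \<le> (10 * lam + 20) * R" using R0 lam by (intro mult_right_mono) auto
      finally show "(\<Sum>j\<in>S i. p j) \<le> (10 * lam + 20) * R" .
    qed
    then show ?thesis using worst by (simp add: R_def)
  qed
  ultimately show ?thesis using S by (auto simp: D_def)
qed

section \<open>From existence of schedules to an algorithm\<close>

theorem theorem10:
  fixes lam :: real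
  assumes "lam > 0"
  shows "\<exists>A :: sched_algorithm. \<forall>m n pl pu ph.
    m \<ge> 1 \<longrightarrow> pl \<in> scenarios n \<longrightarrow> pu \<in> scenarios n \<longrightarrow> ph \<in> scenarios n \<longrightarrow>
    (\<forall>j\<in>{1..n}. pl j \<le> pu j) \<longrightarrow>
    (\<forall>j\<in>{1..n}. pl j \<le> ph j \<and> ph j \<le> pu j) \<longrightarrow>
      A m n pl pu ph \<in> schedules m n \<and>
      Cmax m (A m n pl pu ph) ph \<le> (1 + 2 / lam) * OPT m n ph \<and>
      (\<forall>\<Gamma>\<in>{1..n}. Cmax_worst m (A m n pl pu ph) (budget_set n pl pu \<Gamma>)
         \<le> (10 * lam + 20) * OPT_rob m n (budget_set n pl pu \<Gamma>))"
proof -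
  define good where "good = (\<lambda>m n pl pu ph S. S \<in> schedules m n \<and>
      Cmax m S ph \<le> (1 + 2 / lam) * OPT m n ph \<and>
      (\<forall>\<Gamma>\<in>{1..n}. Cmax_worst m S (budget_set n pl pu \<Gamma>)
         \<le> (10 * lam + 20) * OPT_rob m n (budget_set n pl pu \<Gamma>)))"
  \<comment> \<open>A fixed choice makes the algorithm a function of its inputs. Since
    \<open>good\<close> quantifies over all budgets, one chosen schedule serves every
    \<open>\<Gamma>\<close>.\<close>
  define A :: sched_algorithm where "A = (\<lambda>m n pl pu ph. SOME S. good m n pl pu ph S)"
  have "good m n pl pu ph (A m n pl pu ph)"
    if "m \<ge> 1" "pl \<in> scenarios n" "pu \<in> scenarios n" "ph \<in> scenarios n"
      "\<forall>j\<in>{1..n}. pl j \<le> pu j" "\<forall>j\<in>{1..n}. pl j \<le> ph j \<and> ph j \<le> pu j"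
    for m n pl pu ph
  proof -
    have "\<exists>S. good m n pl pu ph S"
      using exists_consistent_robust_schedule[OF assms that] by (simp add: good_def Bex_def)
    then show ?thesis unfolding A_def by (rule someI_ex)
  qed
  then show ?thesis unfolding good_def by (intro exI[of _ A] allI impI)
qed

end
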